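(* Let $p\geq 3$ be a prime, and for $c\in\mathbb{F}_p$ let $h_c:\mathbb{F}_p\to\mathbb{F}_p$, $h_c(x)=x^2+c$. Let $a\in\mathbb{F}_p$. (1) If $a$ is a quadratic non-residue modulo $p$, then the diagonal line $j=i+a$ is a desert line of $\mathrm{PPD}(h_c,p)$. (2) If $a$ is a quadratic residue modulo $p$, then there are exactly two fixed points on the diagonal line $j=i+a$. (3) If $a=0$, then there is exactly one fixed point on the diagonal line $j=i$. Hence there are exactly $(p-1)/2$ desert lines in $\mathrm{PPD}(h_c,p)$.
   Context: All arithmetic is in the prime field $\mathbb{F}_p$. For a map $h$, $h^r$ denotes its $r$-fold composition. A point $x\in\mathbb{F}_p$ is a periodic point of $h_c$ if $h_c^r(x)=x$ for some $r\geq 1$; it is a fixed point if $h_c(x)=x$. The periodic point diagram $\mathrm{PPD}(h_c,p)$ of the family $(h_c)_{c\in\mathbb{F}_p}$ is the set of marked positions $(i,j)\in\mathbb{F}_p\times\mathbb{F}_p$ such that $j$ is a periodic point of $h_i$ (the first coordinate is the parameter $c=i$, the second coordinate is the point $x=j$). For $a\in\mathbb{F}_p$, the diagonal line $j=i+a$ is the set of all positions $(i,i+a)$, $i\in\mathbb{F}_p$. A desert line is a diagonal line containing no periodic points, i.e. such that for every $i\in\mathbb{F}_p$ the point $i+a$ is not a periodic point of $h_i$. A fixed point on the line $j=i+a$ is a position $(i,i+a)$ with $h_i(i+a)=i+a$. An element $a\in\mathbb{F}_p$, $a\neq 0$, is a quadratic residue if $x^2=a$ has a solution in $\mathbb{F}_p$,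 and a quadratic non-residue otherwise. *)

theory Defs
  imports "HOL-Number_Theory.Number_Theory"
begin

text \<open>The prime field with p elements is the library ring \<^const>\<open>residue_ring\<close>, with carrier
  \<open>{0..p - 1}\<close> and operations reduced modulo \<open>p\<close>. A family of maps \<open>h\<close> takes the parameter first
  and the point second; its values matter only on the carrier.\<close>

abbreviation prime_field :: "nat \<Rightarrow> int ring" where
  "prime_field p \<equiv> residue_ring (int p)"

definition quadratic_family :: "nat \<Rightarrow> int \<Rightarrow> int \<Rightarrow> int" where
  "quadratic_family p c x = x [^]\<^bsub>prime_field p\<^esub> (2::nat) \<oplus>\<^bsub>prime_field p\<^esub> c"

definition periodic_point :: "(int \<Rightarrow> int) \<Rightarrow> int \<Rightarrow> bool" where
  "periodic_point f x \<longleftrightarrow> (\<exists>r\<ge>1. (f ^^ r) x = x)"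

definition fixed_point :: "(int \<Rightarrow> int) \<Rightarrow> int \<Rightarrow> bool" where
  "fixed_point f x \<longleftrightarrow> f x = x"

definition PPD :: "(int \<Rightarrow> int \<Rightarrow> int) \<Rightarrow> nat \<Rightarrow> (int \<times> int) set" where
  "PPD h p = {(i, j) \<in> carrier (prime_field p) \<times> carrier (prime_field p). periodic_point (h i) j}"

definition diagonal_line :: "nat \<Rightarrow> int \<Rightarrow> (int \<times> int) set" where
  "diagonal_line p a = {(i, i \<oplus>\<^bsub>prime_field p\<^esub> a) | i. i \<in> carrier (prime_field p)}"

definition desert_line :: "(int \<Rightarrow> int \<Rightarrow> int) \<Rightarrow> nat \<Rightarrow> (int \<times> int) set \<Rightarrow> bool" where
  "desert_line h p L \<longleftrightarrow> (\<exists>a \<in> carrier (prime_field p). L = diagonal_line p a) \<and> L \<inter> PPD h p = {}"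

definition fixed_points_on :: "(int \<Rightarrow> int \<Rightarrow> int) \<Rightarrow> (int \<times> int) set \<Rightarrow> (int \<times> int) set" where
  "fixed_points_on h L = {(i, j) \<in> L. fixed_point (h i) j}"

text \<open>The library predicate \<^const>\<open>QuadRes\<close> also holds at 0, which is neither a quadratic residue
  nor a quadratic non-residue here.\<close>

definition quadratic_residue :: "nat \<Rightarrow> int \<Rightarrow> bool" where
  "quadratic_residue p a \<longleftrightarrow> a \<noteq> \<zero>\<^bsub>prime_field p\<^esub> \<and> QuadRes (int p) a"

definition quadratic_nonresidue :: "nat \<Rightarrow> int \<Rightarrow> bool" where
  "quadratic_nonresidue p a \<longleftrightarrow> a \<noteq> \<zero>\<^bsub>prime_field p\<^esub> \<and> \<not> QuadRes (int p) a"

end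

theory Submission
  imports Defs
begin

text \<open>Both halves rest on the same congruence. A periodic point of \<open>h\<^sub>i\<close> is in particular a value of
  \<open>h\<^sub>i\<close>, and \<open>i + a = y\<^sup>2 + i\<close> says that \<open>a = y\<^sup>2\<close>: so a line that meets the diagram has \<open>a\<close> a
  square. Conversely, \<open>i + a\<close> is fixed by \<open>h\<^sub>i\<close> exactly when \<open>(i + a)\<^sup>2 = a\<close>, so the fixed points on
  the line correspond to the square roots of \<open>a\<close>, of which there are two for a quadratic residue
  and one for zero. Hence the desert lines are exactly those of the quadratic non-residues.

  To count the non-residues, sort the \<open>p\<close> elements of the field by their squares: with \<open>R\<close> the number
  of quadratic residues this gives \<open>p = 1 + 2 R\<close>, which leaves \<open>(p - 1) / 2\<close> non-residues.\<close>

section \<open>The quadratic family in integer arithmetic\<close>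

lemma carrier_prime_field: "carrier (prime_field p) = {0..<int p}"
  by (auto simp: residue_ring_def)

lemma zero_prime_field: "\<zero>\<^bsub>prime_field p\<^esub> = 0"
  by (simp add: residue_ring_def)

lemma quadratic_family_eq: "quadratic_family p c x = (x\<^sup>2 + c) mod int p"
  by (simp add: quadratic_family_def residue_ring_def nat_pow_def numeral_2_eq_2 mod_simps)

lemma diagonal_line_eq: "diagonal_line p a = (\<lambda>i. (i, (i + a) mod int p)) ` {0..<int p}"
  unfolding diagonal_line_def carrier_prime_field by (auto simp: residue_ring_def)

lemma periodic_point_in_range:
  assumes "periodic_point f x"
  shows "x \<in> range f"
proof -
  obtain r where "r \<ge> 1" "(f ^^ r) x = x"
    using assms by (auto simp: periodic_point_def)
  then have "x = f ((f ^^ (r - 1)) x)"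
    by (cases r) auto
  then show ?thesis by blast
qed

lemma fixed_point_imp_periodic_point: "fixed_point f x \<Longrightarrow> periodic_point f x"
  unfolding fixed_point_def periodic_point_def by (intro exI[of _ 1]) simp

section \<open>Square roots modulo a prime\<close>

definition modular_square_roots :: "nat \<Rightarrow> int \<Rightarrow> int set" where
  "modular_square_roots p a = {y \<in> {0..<int p}. [y\<^sup>2 = a] (mod int p)}"

lemma finite_modular_square_roots: "finite (modular_square_roots p a)"
  unfolding modular_square_roots_def by (rule finite_Collect_conjI) simp

lemma modular_square_roots_nonempty:
  assumes "p > 0" "QuadRes (int p) a"
  shows "modular_square_roots p a \<noteq> {}"
proof -
  obtain y where "[y\<^sup>2 = a] (mod int p)"
    using assms(2) by (auto simp: QuadRes_def)
  then have "y mod int p \<in> modular_square_roots p a"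
    using assms(1) by (simp add: modular_square_roots_def cong_def mod_simps)
  then show ?thesis by blast
qed

lemma modular_square_roots_zero:
  assumes "prime p"
  shows "modular_square_roots p 0 = {0}"
proof -
  have "y = 0" if "0 \<le> y" "y < int p" "int p dvd y\<^sup>2" for y
  proof -
    have "int p dvd y"
      using that(3) assms by (meson prime_dvd_power prime_nat_int_transfer)
    then show "y = 0"
      using that(1,2) zdvd_not_zless by force
  qed
  then show ?thesis
    using assms prime_gt_0_nat by (auto simp: modular_square_roots_def cong_0_iff)
qed

text \<open>In the residue case the two roots are \<open>y\<close> and \<open>p - y\<close>; they differ because \<open>p\<close> is odd, and
  there is no third one because \<open>x\<^sup>2 - y\<^sup>2\<close> factors.\<close>

lemma card_modular_square_roots:
  assumes "prime p" "p \<ge> 3" "quadratic_residue p a" "a \<in> {0..<int p}"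
  shows "card (modular_square_roots p a) = 2"
proof -
  have p: "prime (int p)" using assms(1) by simp
  have a: "a \<noteq> 0" "QuadRes (int p) a"
    using assms(3) by (auto simp: quadratic_residue_def zero_prime_field)
  obtain y where y: "y \<in> modular_square_roots p a"
    using modular_square_roots_nonempty[of p a] a(2) assms(2) by auto
  then have y': "0 \<le> y" "y < int p" "[y\<^sup>2 = a] (mod int p)"
    by (auto simp: modular_square_roots_def)
  have "y \<noteq> 0"
    using y'(3) a(1) assms(4) by (auto simp: cong_def)
  have "modular_square_roots p a = {y, int p - y}"
  proof (intro equalityI subsetI)
    fix x assume "x \<in> modular_square_roots p a"
    then have x: "0 \<le> x" "x < int p" "[x\<^sup>2 = a] (mod int p)"
      by (auto simp: modular_square_roots_def)
    have "[x\<^sup>2 = y\<^sup>2] (mod int p)"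
      using x(3) y'(3) cong_sym cong_trans by blast
    then have "int p dvd (x - y) * (x + y)"
      by (simp add: cong_iff_dvd_diff power2_eq_square algebra_simps)
    then consider "int p dvd x - y" | "int p dvd x + y"
      using p prime_dvd_mult_iff by blast
    then show "x \<in> {y, int p - y}"
    proof cases
      case 1
      then show ?thesis
        using x y' by (metis cong_iff_dvd_diff cong_less_imp_eq_int insert_iff)
    next
      case 2
      then obtain k where k: "x + y = int p * k" by blast
      have "0 < int p * k" "int p * k < int p * 2"
        using x y' \<open>y \<noteq> 0\<close> k by linarith+
      then have "k = 1"
        using assms(2) by (simp add: zero_less_mult_iff)
      then show ?thesis using k by auto
    qed
  next
    have "(int p - y)\<^sup>2 = int p * (int p - 2 * y) + y\<^sup>2"
      by (simp add: power2_eq_square algebra_simps)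
    then have "[(int p - y)\<^sup>2 = a] (mod int p)"
      using y'(3) by (simp add: cong_def)
    then show "x \<in> modular_square_roots p a" if "x \<in> {y, int p - y}" for x
      using that y y' \<open>y \<noteq> 0\<close> by (auto simp: modular_square_roots_def)
  qed
  moreover have "y \<noteq> int p - y"
  proof
    assume "y = int p - y"
    then have "int p = 2 * y" by linarith
    then have "even p" by presburger
    then show False
      using assms(1,2) prime_odd_nat[of p] by auto
  qed
  ultimately show ?thesis by simp
qed

text \<open>Every field element is a square root of exactly one element, which turns the sizes of the
  sets of square roots into a count of the quadratic residues.\<close>

lemma card_quadratic_nonresidues:
  assumes "prime p" "p \<ge> 3"
  shows "card {a \<in> {0..<int p}. quadratic_nonresidue p a} = (p - 1) div 2"
proof -
  let ?F = "{0..<int p}"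
  let ?R = "{a \<in> ?F. quadratic_residue p a}"
  let ?N = "{a \<in> ?F. quadratic_nonresidue p a}"
  let ?roots = "modular_square_roots p"
  have "QuadRes (int p) 0"
    unfolding QuadRes_def by (intro exI[of _ 0]) simp
  then have split: "?F = insert 0 (?R \<union> ?N)"
    using assms(2) by (auto simp: quadratic_residue_def quadratic_nonresidue_def zero_prime_field)
  have notin: "0 \<notin> ?R \<union> ?N"
    by (auto simp: quadratic_residue_def quadratic_nonresidue_def zero_prime_field)
  have disj: "?R \<inter> ?N = {}"
    by (auto simp: quadratic_residue_def quadratic_nonresidue_def)
  have fin: "finite ?R" "finite ?N"
    by (rule finite_subset[of _ ?F]; auto)+
  have N0: "?roots a = {}" if "a \<in> ?N" for a
    using that by (auto simp: quadratic_nonresidue_def modular_square_roots_def QuadRes_def)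
  have "?F = (\<Union>a\<in>?F. ?roots a)"
  proof (intro equalityI subsetI)
    fix y assume "y \<in> ?F"
    then have "y \<in> ?roots (y\<^sup>2 mod int p)" "y\<^sup>2 mod int p \<in> ?F"
      by (auto simp: modular_square_roots_def cong_def)
    then show "y \<in> (\<Union>a\<in>?F. ?roots a)" by blast
  qed (auto simp: modular_square_roots_def)
  then have "p = card (\<Union>a\<in>?F. ?roots a)"
    by (metis card_atLeastLessThan_int diff_zero nat_int)
  also have "\<dots> = (\<Sum>a\<in>?F. card (?roots a))"
    by (rule card_UN_disjoint)
      (auto simp: finite_modular_square_roots, auto simp: modular_square_roots_def cong_def)
  also have "\<dots> = card (?roots 0) + ((\<Sum>a\<in>?R. card (?roots a)) + (\<Sum>a\<in>?N. card (?roots a)))"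
    using fin disj notin by (subst split) (simp add: sum.union_disjoint)
  also have "\<dots> = 1 + 2 * card ?R"
    using card_modular_square_roots[OF assms] N0 by (simp add: modular_square_roots_zero[OF assms(1)])
  finally have "p = 1 + 2 * card ?R" .
  moreover have "p = 1 + card ?R + card ?N"
  proof -
    have "p = card ?F" by simp
    also have "\<dots> = 1 + card (?R \<union> ?N)"
      using fin notin by (subst split) simp
    finally show ?thesis
      using fin disj by (simp add: card_Un_disjoint)
  qed
  ultimately show ?thesis by linarith
qed

section \<open>Periodic and fixed points on a diagonal line\<close>

lemma diagonal_line_inj: "inj_on (diagonal_line p) {0..<int p}"
proof (rule inj_onI)
  fix a b
  assume ab: "a \<in> {0..<int p}" "b \<in> {0..<int p}" "diagonal_line p a = diagonal_line p b"
  \<comment> \<open>The only point of a line with first coordinate \<open>0\<close> has its offset as second coordinate.\<close>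
  have "(0, a) \<in> diagonal_line p a"
    using ab(1) by (auto simp: diagonal_line_eq intro!: image_eqI[of _ _ 0])
  then show "a = b"
    using ab by (auto simp: diagonal_line_eq)
qed

lemma periodic_point_on_diagonal_imp_QuadRes:
  assumes "periodic_point (quadratic_family p i) ((i + a) mod int p)"
  shows "QuadRes (int p) a"
proof -
  obtain y where "(i + a) mod int p = (y\<^sup>2 + i) mod int p"
    using periodic_point_in_range[OF assms] by (auto simp: quadratic_family_eq)
  then have "[i + y\<^sup>2 = i + a] (mod int p)"
    by (simp add: cong_def add.commute)
  then show ?thesis
    unfolding QuadRes_def cong_add_lcancel by blast
qed

lemma fixed_point_on_diagonal_iff:
  "fixed_point (quadratic_family p i) ((i + a) mod int p) \<longleftrightarrow> [((i + a) mod int p)\<^sup>2 = a] (mod int p)"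
proof -
  have "fixed_point (quadratic_family p i) ((i + a) mod int p) \<longleftrightarrow>
      [i + ((i + a) mod int p)\<^sup>2 = i + a] (mod int p)"
    by (simp add: fixed_point_def quadratic_family_eq cong_def add.commute)
  then show ?thesis by (simp only: cong_add_lcancel)
qed

text \<open>A point of a diagonal line is determined by its second coordinate, and at a fixed point this
  coordinate is a square root of \<open>a\<close>.\<close>

lemma bij_betw_fixed_points_modular_square_roots:
  assumes "p > 0"
  shows "bij_betw snd (fixed_points_on (quadratic_family p) (diagonal_line p a))
           (modular_square_roots p a)"
proof (rule bij_betw_byWitness[where f' = "\<lambda>y. ((y - a) mod int p, y)"])
  show "\<forall>z\<in>fixed_points_on (quadratic_family p) (diagonal_line p a).
      ((snd z - a) mod int p, snd z) = z"
    by (auto simp: fixed_points_on_def diagonal_line_eq mod_simps)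
  show "\<forall>y\<in>modular_square_roots p a. snd ((y - a) mod int p, y) = y" by simp
  show "snd ` fixed_points_on (quadratic_family p) (diagonal_line p a) \<subseteq> modular_square_roots p a"
    using assms
    by (auto simp: fixed_points_on_def diagonal_line_eq fixed_point_on_diagonal_iff
        modular_square_roots_def)
  show "(\<lambda>y. ((y - a) mod int p, y)) ` modular_square_roots p a
      \<subseteq> fixed_points_on (quadratic_family p) (diagonal_line p a)"
  proof (rule image_subsetI)
    fix y assume "y \<in> modular_square_roots p a"
    then have y: "y = ((y - a) mod int p + a) mod int p" "[y\<^sup>2 = a] (mod int p)"
      by (auto simp: modular_square_roots_def mod_simps)
    have "((y - a) mod int p, y) \<in> diagonal_line p a"
      unfolding diagonal_line_eq using y(1) assms by (intro image_eqI[of _ _ "(y - a) mod int p"]) auto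
    moreover have "fixed_point (quadratic_family p ((y - a) mod int p)) y"
      using fixed_point_on_diagonal_iff[of p "(y - a) mod int p" a] y by simp
    ultimately show "((y - a) mod int p, y) \<in> fixed_points_on (quadratic_family p) (diagonal_line p a)"
      by (simp add: fixed_points_on_def)
  qed
qed

lemma card_fixed_points_on_diagonal:
  assumes "p > 0"
  shows "card (fixed_points_on (quadratic_family p) (diagonal_line p a)) =
         card (modular_square_roots p a)"
  by (rule bij_betw_same_card[OF bij_betw_fixed_points_modular_square_roots[OF assms]])

text \<open>One direction holds since periodic points are values of the map, the other since a square root
  of \<open>a\<close> already provides a fixed point.\<close>

lemma desert_line_diagonal_iff:
  assumes "p > 0" "a \<in> {0..<int p}"
  shows "desert_line (quadratic_family p) p (diagonal_line p a) \<longleftrightarrow> quadratic_nonresidue p a"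
proof -
  have "QuadRes (int p) 0"
    unfolding QuadRes_def by (intro exI[of _ 0]) simp
  then have nonres: "quadratic_nonresidue p a \<longleftrightarrow> \<not> QuadRes (int p) a"
    by (auto simp: quadratic_nonresidue_def zero_prime_field)
  have "diagonal_line p a \<inter> PPD (quadratic_family p) p = {}" if "\<not> QuadRes (int p) a"
    using that periodic_point_on_diagonal_imp_QuadRes
    by (auto simp: diagonal_line_eq PPD_def)
  moreover have "diagonal_line p a \<inter> PPD (quadratic_family p) p \<noteq> {}" if Q: "QuadRes (int p) a"
  proof -
    have "fixed_points_on (quadratic_family p) (diagonal_line p a) \<noteq> {}"
      using bij_betw_fixed_points_modular_square_roots[OF assms(1), of a]
        modular_square_roots_nonempty[OF assms(1) Q]
      by (auto simp: bij_betw_def)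
    moreover have "fixed_points_on (quadratic_family p) (diagonal_line p a) \<subseteq> PPD (quadratic_family p) p"
      using assms(1)
      by (auto simp: fixed_points_on_def diagonal_line_eq PPD_def carrier_prime_field
          intro: fixed_point_imp_periodic_point)
    ultimately show ?thesis
      by (fastforce simp: fixed_points_on_def)
  qed
  ultimately show ?thesis
    using assms(2) nonres unfolding desert_line_def carrier_prime_field by blast
qed

theorem theorem3p3:
  fixes p :: nat
  assumes "prime p" and "p \<ge> 3"
  shows "(\<forall>a \<in> carrier (prime_field p).
            (quadratic_nonresidue p a \<longrightarrow>
               desert_line (quadratic_family p) p (diagonal_line p a)) \<and>
            (quadratic_residue p a \<longrightarrow>
               card (fixed_points_on (quadratic_family p) (diagonal_line p a)) = 2) \<and>
            (a = \<zero>\<^bsub>prime_field p\<^esub> \<longrightarrow>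
               card (fixed_points_on (quadratic_family p) (diagonal_line p a)) = 1)) \<and>
         card {L. desert_line (quadratic_family p) p L} = (p - 1) div 2"
proof -
  have p: "p > 0" using assms(2) by simp
  have "{L. desert_line (quadratic_family p) p L} =
      diagonal_line p ` {a \<in> {0..<int p}. quadratic_nonresidue p a}"
  proof (intro equalityI subsetI)
    fix L assume "L \<in> {L. desert_line (quadratic_family p) p L}"
    then obtain a where "a \<in> {0..<int p}" "L = diagonal_line p a"
        "desert_line (quadratic_family p) p (diagonal_line p a)"
      unfolding desert_line_def carrier_prime_field by blast
    then show "L \<in> diagonal_line p ` {a \<in> {0..<int p}. quadratic_nonresidue p a}"
      using desert_line_diagonal_iff[OF p] by blast
  qed (auto simp: desert_line_diagonal_iff[OF p])
  moreover have "inj_on (diagonal_line p) {a \<in> {0..<int p}. quadratic_nonresidue p a}"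
    by (rule inj_on_subset[OF diagonal_line_inj]) auto
  ultimately have "card {L. desert_line (quadratic_family p) p L} = (p - 1) div 2"
    using card_quadratic_nonresidues[OF assms] by (simp only: card_image)
  then show ?thesis
    using desert_line_diagonal_iff[OF p] card_modular_square_roots[OF assms]
      modular_square_roots_zero[OF assms(1)]
    by (simp add: carrier_prime_field zero_prime_field card_fixed_points_on_diagonal[OF p])
qed

end
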